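(* Let $\mathcal{F}=\langle X,R\rangle$ be a Kripke frame ($X$ a nonempty set, $R\subseteq X\times X$). Then $R$ is collusive if and only if $\mathcal{F}\models \Diamond^{\rightarrow}\Diamond^{\leftarrow}\Box^{\rightarrow}A\Rightarrow\Box^{\rightarrow}A$ for every formula $A$.
   Context: $R$ is collusive iff $\forall x,y,z,w\in X\,\big((xRy\wedge xRz\wedge wRy)\Rightarrow wRz\big)$. Formulas are built from propositional atoms with classical connectives and modalities $\Box^{\rightarrow},\Box^{\leftarrow}$, with duals $\Diamond^{\rightarrow}=\neg\Box^{\rightarrow}\neg$, $\Diamond^{\leftarrow}=\neg\Box^{\leftarrow}\neg$. In a model $\mathcal{M}=\langle X,R,V\rangle$ (with $V$ a valuation of atoms), $\mathcal{M},x\models\Box^{\rightarrow}\phi$ iff $\mathcal{M},x'\models\phi$ for all $x'$ with $xRx'$; $\mathcal{M},x\models\Box^{\leftarrow}\phi$ iff $\mathcal{M},x'\models\phi$ for all $x'$ with $x'Rx$; other connectives are classical. $\mathcal{F}\models\phi$ iff $\langle X,R,V\rangle,x\models\phi$ for every valuation $V$ and every $x\in X$. *)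

theory Defs
  imports Main
begin

definition kripke_frame :: "'w set \<Rightarrow> 'w rel \<Rightarrow> bool" where
  "kripke_frame X R \<longleftrightarrow> X \<noteq> {} \<and> R \<subseteq> X \<times> X"

definition collusive :: "'w set \<Rightarrow> 'w rel \<Rightarrow> bool" where
  "collusive X R \<longleftrightarrow>
    (\<forall>x\<in>X. \<forall>y\<in>X. \<forall>z\<in>X. \<forall>w\<in>X.
      (x, y) \<in> R \<and> (x, z) \<in> R \<and> (w, y) \<in> R \<longrightarrow> (w, z) \<in> R)"

text \<open>The type variable \<open>'p\<close> is the type of propositional atoms.  The suffixes
  \<open>F\<close> and \<open>B\<close> stand for the forward (right arrow) and backward (left arrow) modalities.\<close>

datatype 'p fm =
    Atom 'p
  | Falsum
  | Neg "'p fm"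
  | Conj "'p fm" "'p fm"
  | Disj "'p fm" "'p fm"
  | Impl "'p fm" "'p fm"
  | BoxF "'p fm"
  | BoxB "'p fm"

definition DiaF :: "'p fm \<Rightarrow> 'p fm" where
  "DiaF \<phi> = Neg (BoxF (Neg \<phi>))"

definition DiaB :: "'p fm \<Rightarrow> 'p fm" where
  "DiaB \<phi> = Neg (BoxB (Neg \<phi>))"

definition valuation :: "'w set \<Rightarrow> ('p \<Rightarrow> 'w set) \<Rightarrow> bool" where
  "valuation X V \<longleftrightarrow> (\<forall>p. V p \<subseteq> X)"

primrec sat :: "'w set \<Rightarrow> 'w rel \<Rightarrow> ('p \<Rightarrow> 'w set) \<Rightarrow> 'w \<Rightarrow> 'p fm \<Rightarrow> bool" where
  "sat X R V x (Atom p) \<longleftrightarrow> x \<in> V p"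
| "sat X R V x Falsum \<longleftrightarrow> False"
| "sat X R V x (Neg \<phi>) \<longleftrightarrow> \<not> sat X R V x \<phi>"
| "sat X R V x (Conj \<phi> \<psi>) \<longleftrightarrow> sat X R V x \<phi> \<and> sat X R V x \<psi>"
| "sat X R V x (Disj \<phi> \<psi>) \<longleftrightarrow> sat X R V x \<phi> \<or> sat X R V x \<psi>"
| "sat X R V x (Impl \<phi> \<psi>) \<longleftrightarrow> (sat X R V x \<phi> \<longrightarrow> sat X R V x \<psi>)"
| "sat X R V x (BoxF \<phi>) \<longleftrightarrow> (\<forall>x'\<in>X. (x, x') \<in> R \<longrightarrow> sat X R V x' \<phi>)"
| "sat X R V x (BoxB \<phi>) \<longleftrightarrow> (\<forall>x'\<in>X. (x', x) \<in> R \<longrightarrow> sat X R V x' \<phi>)"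

definition frame_valid :: "'w set \<Rightarrow> 'w rel \<Rightarrow> 'p fm \<Rightarrow> bool" where
  "frame_valid X R \<phi> \<longleftrightarrow> (\<forall>V. valuation X V \<longrightarrow> (\<forall>x\<in>X. sat X R V x \<phi>))"

end

theory Submission
  imports Defs
begin

text \<open>The antecedent at \<open>x\<close> yields \<open>y\<close>, \<open>w\<close> with
  \<open>x\<close> and \<open>w\<close> both related to \<open>y\<close> and \<open>A\<close> true
  at all successors of \<open>w\<close>. Collusiveness makes each successor of \<open>x\<close> a
  successor of \<open>w\<close>, so \<open>BoxF A\<close> holds at \<open>x\<close>. Conversely, let
  an atom hold exactly at the successors of \<open>w\<close>; validity then forces every successor
  of \<open>x\<close> to be one of \<open>w\<close>.\<close>

lemma sat_DiaF: "sat X R V x (DiaF \<phi>) \<longleftrightarrow> (\<exists>y\<in>X. (x, y) \<in> R \<and> sat X R V y \<phi>)"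
  by (auto simp: DiaF_def)

lemma sat_DiaB: "sat X R V x (DiaB \<phi>) \<longleftrightarrow> (\<exists>y\<in>X. (y, x) \<in> R \<and> sat X R V y \<phi>)"
  by (auto simp: DiaB_def)

theorem mainTheorem14:
  fixes X :: "'w set" and R :: "'w rel"
  assumes "kripke_frame X R"
  shows "collusive X R \<longleftrightarrow>
    (\<forall>A :: 'p fm. frame_valid X R (Impl (DiaF (DiaB (BoxF A))) (BoxF A)))"
proof
  assume "collusive X R"
  then show "\<forall>A :: 'p fm. frame_valid X R (Impl (DiaF (DiaB (BoxF A))) (BoxF A))"
    unfolding collusive_def frame_valid_def sat.simps sat_DiaF sat_DiaB by blast
next
  assume valid: "\<forall>A :: 'p fm. frame_valid X R (Impl (DiaF (DiaB (BoxF A))) (BoxF A))"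
  show "collusive X R"
    unfolding collusive_def
  proof (intro ballI impI)
    fix x y z w
    assume X: "x \<in> X" "y \<in> X" "z \<in> X" "w \<in> X"
      and R: "(x, y) \<in> R \<and> (x, z) \<in> R \<and> (w, y) \<in> R"
    \<comment> \<open>The least valuation making the box of an atom true at \<open>w\<close>.\<close>
    define V :: "'p \<Rightarrow> 'w set" where "V = (\<lambda>_. {v \<in> X. (w, v) \<in> R})"
    \<comment> \<open>Any atom serves, since \<open>V\<close> is constant; one exists because types
      are nonempty.\<close>
    fix p :: 'p
    have "valuation X V"
      by (auto simp: valuation_def V_def)
    with valid X(1)
    have imp: "sat X R V x (Impl (DiaF (DiaB (BoxF (Atom p)))) (BoxF (Atom p)))"
      unfolding frame_valid_def by blast
    have "sat X R V w (BoxF (Atom p))"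
      by (simp add: V_def)
    \<comment> \<open>The witnesses are \<open>y\<close> for \<open>DiaF\<close> and
      \<open>w\<close> for \<open>DiaB\<close>.\<close>
    with X R have "sat X R V x (DiaF (DiaB (BoxF (Atom p))))"
      unfolding sat_DiaF sat_DiaB by blast
    with imp have "sat X R V x (BoxF (Atom p))"
      by simp
    with X R show "(w, z) \<in> R"
      by (simp add: V_def)
  qed
qed

end
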